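(* Let $X$ be a $W$-hyperbolic space, $C\subseteq X$ a convex subset, $T:C\to C$ a nonexpansive mapping with a fixed point $p$, $u,x_0,y_0\in C$, and $(\beta_n)_{n\in\mathbb N},(\lambda_n)_{n\in\mathbb N}$ sequences in $[0,1]$. Let $(x_n)$ be the Tikhonov-Mann iteration starting with $x_0$, $(u_n)$ its associated sequence $u_n=(1-\beta_n)u+\beta_nx_n$, and $(y_n)$ the modified Halpern iteration starting with $y_0$. Let $K\ge 1$ be an integer with $K\ge\max\{d(x_0,p),d(u,p)\}$. Assume that $\lim_{n\to\infty}\beta_n=1$ with rate of convergence $\sigma_4:\mathbb N\to\mathbb N$, and put $\alpha(k)=\sigma_4(2K(k+1)-1)$. Let $\Phi:\mathbb N\to\mathbb N$ and define $\Phi':\mathbb N\to\mathbb N$ by $$\Phi'(k)=\max\{\alpha(3k+2),\Phi(3k+2)\}.$$ (i) If $\Phi$ is a rate of asymptotic regularity (respectively, of $T$-asymptotic regularity) of one of the sequences $(x_n)$, $(u_n)$, then $\Phi'$ is a rate of asymptotic regularity (respectively, of $T$-asymptotic regularity) of the other one. (ii) Suppose, moreover, that $y_0=(1-\beta_0)u+\beta_0x_0$. If one of the sequences $(x_n)$, $(y_n)$ is asymptotically regular (respectively, $T$-asymptotically regular) with rate $\Phi$, then the other one is asymptotically regular (respectively, $T$-asymptotically regular) with rate $\Phi'$.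
   Context: A $W$-space is a metric space $(X,d)$ with a function $W:X\times X\times[0,1]\to X$; one writes $(1-\lambda)x+\lambda y$ for $W(x,y,\lambda)$. It is a $W$-hyperbolic space if for all $x,y,z,w\in X$ and $\lambda,\tilde\lambda\in[0,1]$: (W1) $d(z,(1-\lambda)x+\lambda y)\le(1-\lambda)d(z,x)+\lambda d(z,y)$; (W2) $d((1-\lambda)x+\lambda y,(1-\tilde\lambda)x+\tilde\lambda y)=|\lambda-\tilde\lambda|\,d(x,y)$; (W3) $(1-\lambda)x+\lambda y=\lambda y+(1-\lambda)x$, i.e. $W(x,y,\lambda)=W(y,x,1-\lambda)$; (W4) $d((1-\lambda)x+\lambda z,(1-\lambda)y+\lambda w)\le(1-\lambda)d(x,y)+\lambda d(z,w)$. A nonempty $C\subseteq X$ is convex if $(1-\lambda)x+\lambda y\in C$ for all $x,y\in C$, $\lambda\in[0,1]$. $T$ is nonexpansive if $d(Tx,Ty)\le d(x,y)$ for all $x,y\in C$. Tikhonov-Mann iteration: $x_{n+1}=(1-\lambda_n)u_n+\lambda_nTu_n$ with $u_n=(1-\beta_n)u+\beta_nx_n$. Modified Halpern iteration: $y_{n+1}=(1-\beta_{n+1})u+\beta_{n+1}v_n$ with $v_n=(1-\lambda_n)y_n+\lambda_nTy_n$. For a real sequence $a_n\to a$, a rate of convergence is $\varphi:\mathbb N\to\mathbb N$ with $|a_n-a|\le\frac1{k+1}$ for all $k\in\mathbb N$ and $n\ge\varphi(k)$. A rate of asymptotic regularity (resp. $T$-asymptotic regularity) of a sequence $(a_n)$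 in $C$ is a rate of convergence of $(d(a_n,a_{n+1}))$ (resp. of $(d(a_n,Ta_n))$) to $0$; the sequence is then called asymptotically regular (resp. $T$-asymptotically regular) with that rate. *)

theory Defs
  imports "HOL-Analysis.Analysis"
begin

text \<open>
  \<open>W x y t\<close> stands for the convex combination \<open>(1 - t) x + t y\<close>. Only its values for
  \<open>t \<in> {0..1}\<close> are meaningful; nothing is assumed about other values of \<open>t\<close>.
\<close>

locale W_hyperbolic_space =
  fixes W :: "'a::metric_space \<Rightarrow> 'a \<Rightarrow> real \<Rightarrow> 'a"
  assumes W1: "t \<in> {0..1} \<Longrightarrow> dist z (W x y t) \<le> (1 - t) * dist z x + t * dist z y"
    and W2: "\<lbrakk>s \<in> {0..1}; t \<in> {0..1}\<rbrakk> \<Longrightarrow> dist (W x y s) (W x y t) = \<bar>s - t\<bar> * dist x y"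
    and W3: "t \<in> {0..1} \<Longrightarrow> W x y t = W y x (1 - t)"
    and W4: "t \<in> {0..1} \<Longrightarrow>
      dist (W x z t) (W y w t) \<le> (1 - t) * dist x y + t * dist z w"

definition W_convex :: "('a \<Rightarrow> 'a \<Rightarrow> real \<Rightarrow> 'a) \<Rightarrow> 'a set \<Rightarrow> bool" where
  "W_convex W C \<longleftrightarrow> C \<noteq> {} \<and> (\<forall>x\<in>C. \<forall>y\<in>C. \<forall>t\<in>{0..1}. W x y t \<in> C)"

definition nonexpansive_on :: "'a::metric_space set \<Rightarrow> ('a \<Rightarrow> 'a) \<Rightarrow> bool" where
  "nonexpansive_on C T \<longleftrightarrow> (\<forall>x\<in>C. \<forall>y\<in>C. dist (T x) (T y) \<le> dist x y)"

primrec tikhonov_mann ::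
  "('a \<Rightarrow> 'a \<Rightarrow> real \<Rightarrow> 'a) \<Rightarrow> ('a \<Rightarrow> 'a) \<Rightarrow> 'a \<Rightarrow> (nat \<Rightarrow> real) \<Rightarrow> (nat \<Rightarrow> real) \<Rightarrow> 'a \<Rightarrow> nat \<Rightarrow> 'a"
where
  "tikhonov_mann W T u \<beta> l x0 0 = x0"
| "tikhonov_mann W T u \<beta> l x0 (Suc n) =
     (let un = W u (tikhonov_mann W T u \<beta> l x0 n) (\<beta> n) in W un (T un) (l n))"

definition tikhonov_mann_assoc ::
  "('a \<Rightarrow> 'a \<Rightarrow> real \<Rightarrow> 'a) \<Rightarrow> ('a \<Rightarrow> 'a) \<Rightarrow> 'a \<Rightarrow> (nat \<Rightarrow> real) \<Rightarrow> (nat \<Rightarrow> real) \<Rightarrow> 'a \<Rightarrow> nat \<Rightarrow> 'a"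
where
  "tikhonov_mann_assoc W T u \<beta> l x0 n = W u (tikhonov_mann W T u \<beta> l x0 n) (\<beta> n)"

primrec modified_halpern ::
  "('a \<Rightarrow> 'a \<Rightarrow> real \<Rightarrow> 'a) \<Rightarrow> ('a \<Rightarrow> 'a) \<Rightarrow> 'a \<Rightarrow> (nat \<Rightarrow> real) \<Rightarrow> (nat \<Rightarrow> real) \<Rightarrow> 'a \<Rightarrow> nat \<Rightarrow> 'a"
where
  "modified_halpern W T u \<beta> l y0 0 = y0"
| "modified_halpern W T u \<beta> l y0 (Suc n) =
     (let yn = modified_halpern W T u \<beta> l y0 n; vn = W yn (T yn) (l n)
      in W u vn (\<beta> (Suc n)))"

definition rate_of_convergence :: "(nat \<Rightarrow> nat) \<Rightarrow> (nat \<Rightarrow> real) \<Rightarrow> real \<Rightarrow> bool" where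
  "rate_of_convergence \<phi> a L \<longleftrightarrow>
     a \<longlonglongrightarrow> L \<and> (\<forall>k. \<forall>n\<ge>\<phi> k. \<bar>a n - L\<bar> \<le> 1 / (real k + 1))"

definition rate_of_asymptotic_regularity ::
  "(nat \<Rightarrow> nat) \<Rightarrow> (nat \<Rightarrow> 'a::metric_space) \<Rightarrow> bool" where
  "rate_of_asymptotic_regularity \<phi> a \<longleftrightarrow>
     rate_of_convergence \<phi> (\<lambda>n. dist (a n) (a (Suc n))) 0"

definition rate_of_T_asymptotic_regularity ::
  "('a \<Rightarrow> 'a) \<Rightarrow> (nat \<Rightarrow> nat) \<Rightarrow> (nat \<Rightarrow> 'a::metric_space) \<Rightarrow> bool" where
  "rate_of_T_asymptotic_regularity T \<phi> a \<longleftrightarrow>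
     rate_of_convergence \<phi> (\<lambda>n. dist (a n) (T (a n))) 0"

end

theory Submission
  imports Defs
begin

text \<open>
  The distance between \<open>x n\<close> and \<open>un n\<close> equals \<open>(1 - \<beta> n) * dist u (x n) \<le> 2 * K * (1 - \<beta> n)\<close>,
  so it tends to 0 with rate \<open>\<alpha>\<close>, and both regularity notions pass between sequences whose
  distance tends to 0, by the triangle inequality with three summands below \<open>1 / (3 * (k + 1))\<close>.
  If \<open>y0 = W u x0 (\<beta> 0)\<close>, then \<open>y\<close> and \<open>un\<close> are the same sequence.
\<close>

text \<open>Since \<open>1 / (real k + 1)\<close> drops below every positive bound, the quantitative
  estimate alone already forces the limit; so every rate below is proved by its estimate
  only.\<close>

lemma rate_of_convergenceI:
  assumes "\<And>k n. n \<ge> \<phi> k \<Longrightarrow> \<bar>a n - L\<bar> \<le> 1 / (real k + 1)"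
  shows "rate_of_convergence \<phi> a L"
proof -
  have "\<exists>n0. \<forall>n\<ge>n0. norm (a n - L) < e" if "e > 0" for e
  proof -
    obtain k where "1 / (real k + 1) < e"
      using nat_approx_posE[OF \<open>e > 0\<close>] by (metis of_nat_Suc add.commute)
    then have "\<forall>n\<ge>\<phi> k. norm (a n - L) < e"
      using assms by fastforce
    then show ?thesis ..
  qed
  then have "a \<longlonglongrightarrow> L"
    by (rule LIMSEQ_I)
  then show ?thesis
    using assms by (simp add: rate_of_convergence_def)
qed

lemma rate_of_convergenceD:
  "rate_of_convergence \<phi> a L \<Longrightarrow> n \<ge> \<phi> k \<Longrightarrow> \<bar>a n - L\<bar> \<le> 1 / (real k + 1)"
  by (simp add: rate_of_convergence_def)

text \<open>Explains the index \<open>3 * k + 2\<close>: adding one gives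
  \<open>3 * (k + 1)\<close>, so each of three summands gets a third of the allowed error.\<close>

lemma third_of_rate: "3 * (1 / (real (3 * k + 2) + 1)) = 1 / (real k + 1)"
  by (simp add: field_simps)

lemma rate_of_asymptotic_regularity_transfer:
  assumes a: "rate_of_asymptotic_regularity \<Phi> a"
    and ab: "rate_of_convergence \<alpha> (\<lambda>n. dist (a n) (b n)) 0"
  shows "rate_of_asymptotic_regularity (\<lambda>k. max (\<alpha> (3 * k + 2)) (\<Phi> (3 * k + 2))) b"
  unfolding rate_of_asymptotic_regularity_def
proof (rule rate_of_convergenceI)
  fix k n
  assume n: "max (\<alpha> (3 * k + 2)) (\<Phi> (3 * k + 2)) \<le> n"
  let ?e = "1 / (real (3 * k + 2) + 1)"
  have "dist (a n) (a (Suc n)) \<le> ?e"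
    using rate_of_convergenceD[OF a[unfolded rate_of_asymptotic_regularity_def], of "3 * k + 2" n] n
    by simp
  \<comment> \<open>The rate bounds all later indices, so one threshold serves both \<open>n\<close>
    and \<open>Suc n\<close>.\<close>
  moreover have "dist (a n) (b n) \<le> ?e" "dist (a (Suc n)) (b (Suc n)) \<le> ?e"
    using rate_of_convergenceD[OF ab, of "3 * k + 2" n]
      rate_of_convergenceD[OF ab, of "3 * k + 2" "Suc n"] n by simp_all
  moreover have "dist (b n) (b (Suc n))
      \<le> dist (a n) (b n) + dist (a n) (a (Suc n)) + dist (a (Suc n)) (b (Suc n))"
    by metric
  ultimately show "\<bar>dist (b n) (b (Suc n)) - 0\<bar> \<le> 1 / (real k + 1)"
    using third_of_rate[of k] by simp
qed

lemma rate_of_T_asymptotic_regularity_transfer: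
  assumes T: "nonexpansive_on C T" and C: "\<And>n. a n \<in> C" "\<And>n. b n \<in> C"
    and a: "rate_of_T_asymptotic_regularity T \<Phi> a"
    and ab: "rate_of_convergence \<alpha> (\<lambda>n. dist (a n) (b n)) 0"
  shows "rate_of_T_asymptotic_regularity T (\<lambda>k. max (\<alpha> (3 * k + 2)) (\<Phi> (3 * k + 2))) b"
  unfolding rate_of_T_asymptotic_regularity_def
proof (rule rate_of_convergenceI)
  fix k n
  assume n: "max (\<alpha> (3 * k + 2)) (\<Phi> (3 * k + 2)) \<le> n"
  let ?e = "1 / (real (3 * k + 2) + 1)"
  have "dist (a n) (T (a n)) \<le> ?e"
    using rate_of_convergenceD[OF a[unfolded rate_of_T_asymptotic_regularity_def], of "3 * k + 2" n] n
    by simp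
  moreover have "dist (a n) (b n) \<le> ?e"
    using rate_of_convergenceD[OF ab, of "3 * k + 2" n] n by simp
  \<comment> \<open>Here nonexpansiveness replaces the shift to \<open>Suc n\<close>: the third
    summand is at most the first. It is known only on \<open>C\<close>, so both sequences must stay
    there.\<close>
  moreover have "dist (T (a n)) (T (b n)) \<le> dist (a n) (b n)"
    using T C by (simp add: nonexpansive_on_def)
  moreover have "dist (b n) (T (b n))
      \<le> dist (a n) (b n) + dist (a n) (T (a n)) + dist (T (a n)) (T (b n))"
    by metric
  ultimately show "\<bar>dist (b n) (T (b n)) - 0\<bar> \<le> 1 / (real k + 1)"
    using third_of_rate[of k] by simp
qed

context W_hyperbolic_space
begin

text \<open>The endpoint value is not an axiom: (W1) with \<open>z = y\<close> and
  \<open>t = 1\<close> bounds \<open>dist y (W x y 1)\<close> by 0. With it, (W2) at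
  \<open>s = 1\<close> yields the next lemma.\<close>

lemma W_one [simp]: "W x y 1 = y"
  using W1[of 1 y x y] by simp

lemma dist_W_right: "t \<in> {0..1} \<Longrightarrow> dist y (W x y t) = (1 - t) * dist x y"
  using W2[of 1 t x y] by simp

text \<open>Convexity of closed balls, a direct consequence of (W1).\<close>

lemma dist_W_le:
  assumes "t \<in> {0..1}" "dist z x \<le> r" "dist z y \<le> r"
  shows "dist z (W x y t) \<le> r"
proof -
  have "dist z (W x y t) \<le> (1 - t) * dist z x + t * dist z y"
    using assms(1) by (rule W1)
  also have "\<dots> \<le> r"
    using assms by (intro convex_bound_le) auto
  finally show ?thesis .
qed

lemma tikhonov_mann_in_convex:
  assumes "W_convex W C" "T \<in> C \<rightarrow> C" "u \<in> C" "x0 \<in> C"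
    and "\<And>n. \<beta> n \<in> {0..1}" "\<And>n. l n \<in> {0..1}"
  shows "tikhonov_mann W T u \<beta> l x0 n \<in> C"
proof (induction n)
  case (Suc n)
  have C: "W a b t \<in> C" if "a \<in> C" "b \<in> C" "t \<in> {0..1}" for a b t
    using assms(1) that unfolding W_convex_def by blast
  have "W u (tikhonov_mann W T u \<beta> l x0 n) (\<beta> n) \<in> C"
    by (rule C[OF assms(3) Suc.IH assms(5)])
  then show ?case
    unfolding tikhonov_mann.simps Let_def by (intro C[OF _ funcset_mem[OF assms(2)] assms(6)])
qed (use assms in simp)

text \<open>The closed ball of radius \<open>r\<close> about \<open>p\<close> contains
  \<open>u\<close> and \<open>x0\<close>. Convex combinations stay in it, and so do images under
  \<open>T\<close> of its points in \<open>C\<close>, because \<open>T\<close> is nonexpansive on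
  \<open>C\<close> and fixes \<open>p\<close>.\<close>

lemma dist_tikhonov_mann_fixed_point_le:
  assumes "W_convex W C" "T \<in> C \<rightarrow> C" "nonexpansive_on C T" "u \<in> C" "x0 \<in> C"
    and "\<And>n. \<beta> n \<in> {0..1}" "\<And>n. l n \<in> {0..1}"
    and "p \<in> C" "T p = p" "dist p u \<le> r" "dist p x0 \<le> r"
  shows "dist p (tikhonov_mann W T u \<beta> l x0 n) \<le> r"
proof (induction n)
  case (Suc n)
  let ?v = "W u (tikhonov_mann W T u \<beta> l x0 n) (\<beta> n)"
  have v: "dist p ?v \<le> r"
    using assms Suc by (intro dist_W_le)
  have "?v \<in> C"
    using assms tikhonov_mann_in_convex[of C T u x0 \<beta> l n] by (simp add: W_convex_def)
  then have "dist p (T ?v) \<le> dist p ?v"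
    using bspec[OF bspec[OF assms(3)[unfolded nonexpansive_on_def] assms(8)]] assms(9) by simp
  then show ?case
    unfolding tikhonov_mann.simps Let_def by (intro dist_W_le[OF assms(7) v] order_trans[OF _ v])
qed (use assms in simp)

lemma rate_of_convergence_tikhonov_mann_assoc:
  assumes conv: "W_convex W C" "T \<in> C \<rightarrow> C" "nonexpansive_on C T" "u \<in> C" "x0 \<in> C"
    and \<beta>: "\<And>n. \<beta> n \<in> {0..1}" and l: "\<And>n. l n \<in> {0..1}"
    and p: "p \<in> C" "T p = p" and K: "K \<ge> 1" "dist p u \<le> real K" "dist p x0 \<le> real K"
    and \<sigma>: "rate_of_convergence \<sigma> \<beta> 1"
  shows "rate_of_convergence (\<lambda>k. \<sigma> (2 * K * (k + 1) - 1))
    (\<lambda>n. dist (tikhonov_mann W T u \<beta> l x0 n) (tikhonov_mann_assoc W T u \<beta> l x0 n)) 0"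
proof (rule rate_of_convergenceI)
  fix k n
  assume n: "\<sigma> (2 * K * (k + 1) - 1) \<le> n"
  let ?x = "tikhonov_mann W T u \<beta> l x0 n"
  \<comment> \<open>Rules out truncation in the natural subtraction, so that the index plus one is
    exactly \<open>2 * K * (k + 1)\<close>.\<close>
  have "2 * K * (k + 1) \<ge> 1"
    using K(1) by simp
  then have idx: "real (2 * K * (k + 1) - 1) + 1 = 2 * real K * (real k + 1)"
    by (simp add: of_nat_diff algebra_simps)
  have \<beta>n: "1 - \<beta> n \<le> 1 / (2 * real K * (real k + 1))"
    using rate_of_convergenceD[OF \<sigma> n] unfolding idx by linarith
  \<comment> \<open>Both points lie in the ball of radius \<open>K\<close> about \<open>p\<close>;
    this is the source of the factor \<open>2 * K\<close> in the index, which cancels below.\<close>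
  have "dist u ?x \<le> dist p u + dist p ?x"
    by metric
  also have "\<dots> \<le> 2 * real K"
    using K dist_tikhonov_mann_fixed_point_le[OF conv _ _ p K(2,3), of \<beta> l n] \<beta> l by simp
  finally have "(1 - \<beta> n) * dist u ?x \<le> 1 / (2 * real K * (real k + 1)) * (2 * real K)"
    using \<beta>n by (intro mult_mono) auto
  also have "\<dots> = 1 / (real k + 1)"
    using K(1) by simp
  finally show "\<bar>dist ?x (tikhonov_mann_assoc W T u \<beta> l x0 n) - 0\<bar> \<le> 1 / (real k + 1)"
    using \<beta>[of n] dist_W_right[OF \<beta>] by (simp add: tikhonov_mann_assoc_def abs_mult)
qed

end

text \<open>Both iterations alternate the same two operations, averaging with \<open>u\<close> and
  averaging with the image under \<open>T\<close>; they differ only in which of the two comes first.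
  In the induction step the auxiliary point \<open>vn\<close> of the Halpern scheme is the next
  Tikhonov-Mann iterate.\<close>

lemma modified_halpern_eq_tikhonov_mann_assoc:
  "modified_halpern W T u \<beta> l (W u x0 (\<beta> 0)) n = tikhonov_mann_assoc W T u \<beta> l x0 n"
  by (induction n) (simp_all add: tikhonov_mann_assoc_def Let_def)

theorem proposition4p2:
  fixes W :: "'a::metric_space \<Rightarrow> 'a \<Rightarrow> real \<Rightarrow> 'a"
    and C :: "'a set" and T :: "'a \<Rightarrow> 'a"
    and p u x0 y0 :: 'a
    and \<beta> l :: "nat \<Rightarrow> real"
    and x un y :: "nat \<Rightarrow> 'a"
    and K :: nat
    and \<sigma>4 \<alpha> \<Phi> \<Phi>' :: "nat \<Rightarrow> nat"
  assumes "W_hyperbolic_space W"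
    and "W_convex W C"
    and "T \<in> C \<rightarrow> C" and "nonexpansive_on C T"
    and "p \<in> C" and "T p = p"
    and "u \<in> C" and "x0 \<in> C" and "y0 \<in> C"
    and "\<And>n. \<beta> n \<in> {0..1}" and "\<And>n. l n \<in> {0..1}"
    and "x = tikhonov_mann W T u \<beta> l x0"
    and "un = tikhonov_mann_assoc W T u \<beta> l x0"
    and "y = modified_halpern W T u \<beta> l y0"
    and "K \<ge> 1" and "real K \<ge> max (dist x0 p) (dist u p)"
    and "rate_of_convergence \<sigma>4 \<beta> 1"
    and "\<And>k. \<alpha> k = \<sigma>4 (2 * K * (k + 1) - 1)"
    and "\<And>k. \<Phi>' k = max (\<alpha> (3 * k + 2)) (\<Phi> (3 * k + 2))"
  shows
    "((rate_of_asymptotic_regularity \<Phi> x \<longrightarrow> rate_of_asymptotic_regularity \<Phi>' un) \<and>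
      (rate_of_asymptotic_regularity \<Phi> un \<longrightarrow> rate_of_asymptotic_regularity \<Phi>' x) \<and>
      (rate_of_T_asymptotic_regularity T \<Phi> x \<longrightarrow> rate_of_T_asymptotic_regularity T \<Phi>' un) \<and>
      (rate_of_T_asymptotic_regularity T \<Phi> un \<longrightarrow> rate_of_T_asymptotic_regularity T \<Phi>' x)) \<and>
     (y0 = W u x0 (\<beta> 0) \<longrightarrow>
      (rate_of_asymptotic_regularity \<Phi> x \<longrightarrow> rate_of_asymptotic_regularity \<Phi>' y) \<and>
      (rate_of_asymptotic_regularity \<Phi> y \<longrightarrow> rate_of_asymptotic_regularity \<Phi>' x) \<and>
      (rate_of_T_asymptotic_regularity T \<Phi> x \<longrightarrow> rate_of_T_asymptotic_regularity T \<Phi>' y) \<and>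
      (rate_of_T_asymptotic_regularity T \<Phi> y \<longrightarrow> rate_of_T_asymptotic_regularity T \<Phi>' x))"
proof -
  interpret W_hyperbolic_space W
    by (rule assms(1))
  have xC: "x n \<in> C" for n
    unfolding \<open>x = _\<close> using assms by (intro tikhonov_mann_in_convex)
  have unC: "un n \<in> C" for n
    using xC[of n] assms(2,7,10) unfolding \<open>x = _\<close> \<open>un = _\<close> W_convex_def tikhonov_mann_assoc_def
    by blast
  have "(\<lambda>k. \<sigma>4 (2 * K * (k + 1) - 1)) = \<alpha>"
    using assms(18) by auto
  then have x_un: "rate_of_convergence \<alpha> (\<lambda>n. dist (x n) (un n)) 0"
    using rate_of_convergence_tikhonov_mann_assoc[of C T u x0 \<beta> l p K \<sigma>4] assms
    by (simp add: dist_commute)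
  then have un_x: "rate_of_convergence \<alpha> (\<lambda>n. dist (un n) (x n)) 0"
    by (simp add: dist_commute)
  have \<Phi>': "\<Phi>' = (\<lambda>k. max (\<alpha> (3 * k + 2)) (\<Phi> (3 * k + 2)))"
    using assms(19) by auto
  have y: "y = un" if "y0 = W u x0 (\<beta> 0)"
    unfolding assms(13,14) that by (rule ext) (rule modified_halpern_eq_tikhonov_mann_assoc)
  note transfer = rate_of_asymptotic_regularity_transfer[OF _ x_un]
    rate_of_asymptotic_regularity_transfer[OF _ un_x]
    rate_of_T_asymptotic_regularity_transfer[OF assms(4) xC unC _ x_un]
    rate_of_T_asymptotic_regularity_transfer[OF assms(4) unC xC _ un_x]
  show ?thesis
    \<comment> \<open>Under the hypothesis of (ii), rewriting \<open>y\<close> to \<open>un\<close>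
      turns its four claims into those of (i); the rewriting is optional because it does not apply
      to (i) itself.\<close>
    unfolding \<Phi>' by (intro conjI impI; (simp only: y)?; erule transfer)
qed

end
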